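(* Let $m\geq1$ and $k=\lceil m/2\rceil$. Inside the $m\times\infty$ table, we have $$\mathcal{M}'(a-1)\,\mathcal{I}_m(n)=2\left(\frac{\mathcal{M}'(k-1)}{\mathcal{M}_m(0)}+\mathcal{M}'(k-2)+\cdots+\mathcal{M}'(0)\right)\mathcal{C}(n,a)$$ for all $a=1,\ldots,k$ and $n\geq1$. In particular, for $a=1$, we have $$\mathcal{I}_m(n)=2\left(\frac{\mathcal{M}'(k-1)}{\mathcal{M}_m(0)}+\mathcal{M}'(k-2)+\cdots+\mathcal{M}'(0)\right)\mathcal{C}(n,1)$$ for all $n\geq1$.
   Context: Table: for an integer $m\geq1$, define $\mathcal{C}(x,y)=\mathcal{C}_m(x,y)$ for $x\geq1$, $1\leq y\leq m$, as the number of lattice paths (sequences of cells of the $m\times\infty$ table with steps in $\{(1,-1),(1,0),(1,1)\}$, first coordinate being the column) from any cell of the first column to the cell $(x,y)$. Equivalently, $\mathcal{C}(1,y)=1$ and $\mathcal{C}(x+1,y)=\mathcal{C}(x,y-1)+\mathcal{C}(x,y)+\mathcal{C}(x,y+1)$, with $\mathcal{C}(x,0)=\mathcal{C}(x,m+1)=0$. The $n$th column sum is $\mathcal{I}_m(n)=\mathcal{C}(n,1)+\cdots+\mathcal{C}(n,m)$. Multipliers: $\Delta$ is the difference operator, $\Delta a(n)=a(n+1)-a(n)$ for a sequence $\{a(n)\}$. $\mathcal{M}'(n)$, $n\geq0$, are the polynomials in $\Delta$ defined by $\mathcal{M}'(0)=1$, $\mathcal{M}'(1)=\Delta$, and $\mathcal{M}'(n+2)=\Delta\mathcal{M}'(n+1)-\mathcal{M}'(n)$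 for all $n\geq0$. The number $\mathcal{M}_m(0)$ equals $2$ if $m$ is odd and $1$ if $m$ is even. Polynomials in $\Delta$ act on $\mathcal{C}(n,i)$ with respect to the variable $n$ (with $i$ fixed), i.e. $\Delta\mathcal{C}(n,i)=\mathcal{C}(n+1,i)-\mathcal{C}(n,i)$, and on $\mathcal{I}_m(n)$ with respect to $n$. For $k=1$ the sum $\mathcal{M}'(k-2)+\cdots+\mathcal{M}'(0)$ is empty. *)

theory Defs
  imports
    Complex_Main
    "HOL-Library.Product_Plus"
    "HOL-Computational_Algebra.Polynomial"
begin

text \<open>Cells are pairs (column, row); the table has \<open>m\<close> rows and infinitely many columns.\<close>

definition table :: "nat \<Rightarrow> (int \<times> int) set" where
  "table m = {(x, y). 1 \<le> x \<and> 1 \<le> y \<and> y \<le> int m}"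

definition steps :: "(int \<times> int) set" where
  "steps = {(1, -1), (1, 0), (1, 1)}"

definition lattice_path :: "nat \<Rightarrow> (int \<times> int) list \<Rightarrow> bool" where
  "lattice_path m p \<longleftrightarrow>
     p \<noteq> [] \<and> set p \<subseteq> table m \<and>
     (\<forall>i. Suc i < length p \<longrightarrow> p ! Suc i - p ! i \<in> steps)"

text \<open>\<open>path_count m x y\<close> is \<open>\<C>\<^sub>m(x, y)\<close>.\<close>

definition path_count :: "nat \<Rightarrow> nat \<Rightarrow> nat \<Rightarrow> nat" where
  "path_count m x y =
     card {p. lattice_path m p \<and> fst (hd p) = 1 \<and> last p = (int x, int y)}"

text \<open>\<open>column_sum m n\<close> is \<open>\<I>\<^sub>m(n)\<close>.\<close>

definition column_sum :: "nat \<Rightarrow> nat \<Rightarrow> nat" where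
  "column_sum m n = (\<Sum>y = 1..m. path_count m n y)"

definition fwd_diff :: "(nat \<Rightarrow> real) \<Rightarrow> nat \<Rightarrow> real" where
  "fwd_diff f n = f (n + 1) - f n"

text \<open>
  A polynomial in \<open>\<Delta>\<close> is an element of \<open>real poly\<close> whose indeterminate stands for \<open>\<Delta>\<close>.
  It acts on sequences by substituting the operator \<open>fwd_diff\<close> for the indeterminate.
  The value of the result at \<open>n\<close> depends only on the values of \<open>f\<close> at arguments \<open>\<ge> n\<close>, so the
  junk values of the sequences of interest at \<open>0\<close> never matter when \<open>n \<ge> 1\<close>.
\<close>

definition act :: "real poly \<Rightarrow> (nat \<Rightarrow> real) \<Rightarrow> nat \<Rightarrow> real" where
  "act p f n = (\<Sum>i\<le>degree p. coeff p i * (fwd_diff ^^ i) f n)"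

text \<open>\<open>multiplier' n\<close> is \<open>\<M>'(n)\<close>, with \<open>[:0, 1:]\<close> playing the role of \<open>\<Delta>\<close>.\<close>

fun multiplier' :: "nat \<Rightarrow> real poly" where
  "multiplier' 0 = 1"
| "multiplier' (Suc 0) = [:0, 1:]"
| "multiplier' (Suc (Suc n)) = [:0, 1:] * multiplier' (Suc n) - multiplier' n"

text \<open>The number \<open>\<M>\<^sub>m(0)\<close>.\<close>

definition multiplier_zero :: "nat \<Rightarrow> real" where
  "multiplier_zero m = (if odd m then 2 else 1)"

text \<open>
  The operator \<open>2 (\<M>'(k-1)/\<M>\<^sub>m(0) + \<M>'(k-2) + \<dots> + \<M>'(0))\<close>, for \<open>k \<ge> 1\<close>.
  The sum over \<open>j < k - 1\<close> is empty for \<open>k = 1\<close>.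
\<close>

definition total_multiplier :: "nat \<Rightarrow> nat \<Rightarrow> real poly" where
  "total_multiplier m k =
     smult 2 (smult (1 / multiplier_zero m) (multiplier' (k - 1)) + (\<Sum>j<k - 1. multiplier' j))"

end

theory Submission
  imports Defs
begin

text \<open>
  Since \<open>\<C>(n + 1, y) = \<C>(n, y - 1) + \<C>(n, y) + \<C>(n, y + 1)\<close>, differencing in \<open>n\<close> gives
  \<open>\<Delta>\<C>(n, y) = \<C>(n, y - 1) + \<C>(n, y + 1)\<close>. Solving for \<open>\<C>(n, y + 1)\<close> yields exactly the recursion
  of the multipliers, and \<open>\<C>(n, 0) = 0\<close>, so \<open>\<C>(n, j + 1) = \<M>'(j) \<C>(n, 1)\<close> for \<open>j < m\<close>
  (\<open>act_multiplier_row_one\<close>). The table is symmetric under \<open>y \<mapsto> m + 1 - y\<close>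
  (\<open>path_count_reflect\<close>), so \<open>\<I>\<^sub>m(n)\<close> is twice the sum of the rows \<open>1, \<dots>, k\<close>, except that the
  middle row \<open>k\<close> counts only once when \<open>m\<close> is odd; this is the role of \<open>\<M>\<^sub>m(0)\<close>. Hence the case
  \<open>a = 1\<close>. For general \<open>a\<close>, apply \<open>\<M>'(a - 1)\<close> to both sides: polynomials in \<open>\<Delta>\<close> commute, and
  \<open>\<M>'(a - 1) \<C>(n, 1) = \<C>(n, a)\<close>.

  The recursion for \<open>\<C>\<close> fails at the junk column \<open>n = 0\<close>, so the sequences are shifted by one
  throughout.
\<close>

section \<open>The action of polynomials in the difference operator\<close>

lemma act_eq_sum:
  assumes "degree p \<le> N"
  shows "act p f n = (\<Sum>i\<le>N. coeff p i * (fwd_diff ^^ i) f n)"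
  unfolding act_def
  by (rule sum.mono_neutral_left) (use assms in \<open>auto simp: coeff_eq_0\<close>)

lemma act_0 [simp]: "act 0 f = (\<lambda>n. 0)"
  by (simp add: act_def fun_eq_iff)

lemma act_1 [simp]: "act 1 f = f"
  by (simp add: act_def fun_eq_iff)

text \<open>
  The Horner-style recursion for the action, which permits induction on the coefficient list
  without mention of degrees.
\<close>

lemma act_pCons: "act (pCons a p) f n = a * f n + act p (fwd_diff f) n"
proof -
  have "act (pCons a p) f n =
      (\<Sum>i\<le>Suc (degree p). coeff (pCons a p) i * (fwd_diff ^^ i) f n)"
    by (rule act_eq_sum) (simp add: degree_pCons_le)
  also have "\<dots> = a * f n + act p (fwd_diff f) n"
    by (simp add: sum.atMost_Suc_shift act_def funpow_swap1 del: sum.atMost_Suc)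
  finally show ?thesis .
qed

lemma act_add: "act (p + q) f n = act p f n + act q f n"
proof -
  let ?N = "max (degree p) (degree q)"
  show ?thesis
    by (simp add: act_eq_sum[of _ ?N] degree_add_le sum.distrib ring_distribs)
qed

lemma act_smult: "act (smult c p) f n = c * act p f n"
  by (simp add: act_eq_sum[of _ "degree p"] degree_smult_le sum_distrib_left mult.assoc)

lemma act_diff: "act (p - q) f n = act p f n - act q f n"
  using act_add[of "p - q" q f n] by simp

lemma act_sum: "act (sum p A) f n = (\<Sum>j\<in>A. act (p j) f n)"
  by (induction A rule: infinite_finite_induct) (auto simp: act_add)

lemma fwd_diff_act: "fwd_diff (act p f) = act p (fwd_diff f)"
proof (induction p arbitrary: f)
  case (pCons a p)
  have "fwd_diff (act (pCons a p) f) n = act (pCons a p) (fwd_diff f) n" for n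
    using fun_cong[OF pCons.IH[of "fwd_diff f"], of n]
    by (simp add: fwd_diff_def[of _ n] act_pCons algebra_simps)
  then show ?case by (rule ext)
qed (simp add: fun_eq_iff fwd_diff_def)

lemma act_Delta_mult: "act ([:0, 1:] * p) f = fwd_diff (act p f)"
  by (simp add: fun_eq_iff act_pCons fwd_diff_act)

lemma act_mult: "act (p * q) f = act p (act q f)"
proof (induction p arbitrary: f)
  case (pCons a p)
  then show ?case
    by (simp add: fun_eq_iff act_add act_smult act_pCons fwd_diff_act)
qed simp

lemma act_commute: "act p (act q f) = act q (act p f)"
  by (metis act_mult mult.commute)

lemma act_shift: "act p f (Suc n) = act p (\<lambda>n. f (Suc n)) n"
proof (induction p arbitrary: f n)
  case (pCons a p)
  have "(\<lambda>n. fwd_diff f (Suc n)) = fwd_diff (\<lambda>n. f (Suc n))"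
    by (simp add: fun_eq_iff fwd_diff_def)
  then show ?case
    by (simp add: act_pCons pCons.IH)
qed simp

section \<open>Counting lattice paths\<close>

text \<open>The paths counted by \<open>path_count\<close>, with an arbitrary integer cell as the end point.\<close>

definition paths_to :: "nat \<Rightarrow> int \<times> int \<Rightarrow> (int \<times> int) list set" where
  "paths_to m c = {p. lattice_path m p \<and> fst (hd p) = 1 \<and> last p = c}"

lemma path_count_eq_card: "path_count m x y = card (paths_to m (int x, int y))"
  by (simp add: path_count_def paths_to_def)

lemma paths_to_outside: "c \<notin> table m \<Longrightarrow> paths_to m c = {}"
  by (auto simp: paths_to_def lattice_path_def dest: last_in_set)

lemma lattice_path_snoc:
  "lattice_path m (p @ [c]) \<longleftrightarrow>
     c \<in> table m \<and> (p = [] \<or> lattice_path m p \<and> c - last p \<in> steps)"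
proof (cases "p = []")
  case False
  have split: "(\<forall>i. Suc i < length (p @ [c]) \<longrightarrow> Q i) \<longleftrightarrow>
      (\<forall>i. Suc i < length p \<longrightarrow> Q i) \<and> Q (length p - 1)" for Q
  proof -
    have "Suc i < length (p @ [c]) \<longleftrightarrow> Suc i < length p \<or> i = length p - 1" for i
      using False by (cases p) auto
    then show ?thesis by blast
  qed
  let ?r = "p @ [c]"
  have "?r ! Suc i - ?r ! i = p ! Suc i - p ! i" if "Suc i < length p" for i
    using that by (simp add: nth_append)
  moreover have "?r ! Suc (length p - 1) - ?r ! (length p - 1) = c - last p"
    using False by (simp add: nth_append last_conv_nth)
  ultimately have "(\<forall>i. Suc i < length ?r \<longrightarrow> ?r ! Suc i - ?r ! i \<in> steps) \<longleftrightarrow>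
      (\<forall>i. Suc i < length p \<longrightarrow> p ! Suc i - p ! i \<in> steps) \<and> c - last p \<in> steps"
    unfolding split by simp
  then show ?thesis
    using False unfolding lattice_path_def by (simp only: set_append set_simps) blast
qed (simp add: lattice_path_def)

lemma paths_to_step:
  assumes "(x, y) \<in> table m" "x \<noteq> 1"
  shows "paths_to m (x, y) = (\<lambda>p. p @ [(x, y)]) `
    (paths_to m (x - 1, y - 1) \<union> paths_to m (x - 1, y) \<union> paths_to m (x - 1, y + 1))"
    (is "?L = ?app ` ?R")
proof (rule set_eqI)
  fix p
  show "p \<in> ?L \<longleftrightarrow> p \<in> ?app ` ?R"
  proof (cases p rule: rev_cases)
    case Nil
    then show ?thesis by (auto simp: paths_to_def lattice_path_def)
  next
    case (snoc q c)
    have step: "(x, y) - last q \<in> steps \<longleftrightarrow>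
        last q = (x - 1, y - 1) \<or> last q = (x - 1, y) \<or> last q = (x - 1, y + 1)"
      by (cases "last q") (auto simp: steps_def)
    have "q \<noteq> []" if "q \<in> ?R"
      using that by (auto simp: paths_to_def lattice_path_def)
    moreover have "q \<in> ?R \<longleftrightarrow> lattice_path m q \<and> fst (hd q) = 1 \<and> (x, y) - last q \<in> steps"
      unfolding step by (auto simp: paths_to_def)
    moreover have "p \<in> ?app ` ?R \<longleftrightarrow> c = (x, y) \<and> q \<in> ?R"
      using snoc by auto
    moreover have "p \<in> ?L \<longleftrightarrow> c = (x, y) \<and> q \<noteq> [] \<and> lattice_path m q \<and> fst (hd q) = 1 \<and>
        (x, y) - last q \<in> steps"
      using snoc assms by (cases "q = []") (auto simp: paths_to_def lattice_path_snoc)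
    ultimately show ?thesis by (simp only:) blast
  qed
qed

lemma paths_to_first_column:
  assumes "(1, y) \<in> table m"
  shows "paths_to m (1, y) = {[(1, y)]}"
proof -
  \<comment> \<open>A longer path would have its last but one cell in column \<open>0\<close>, outside the table.\<close>
  have "q = []" if "lattice_path m (q @ [(1, y)])" for q
  proof (rule ccontr)
    assume q: "q \<noteq> []"
    with that have "lattice_path m q" and step: "(1, y) - last q \<in> steps"
      by (auto simp: lattice_path_snoc)
    then have "last q \<in> table m"
      using q by (auto simp: lattice_path_def)
    with step show False
      by (cases "last q") (auto simp: steps_def table_def)
  qed
  then have "p = [(1, y)]" if "p \<in> paths_to m (1, y)" for p
    using that by (cases p rule: rev_cases) (auto simp: paths_to_def lattice_path_def)
  moreover have "[(1, y)] \<in> paths_to m (1, y)"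
    using assms by (simp add: paths_to_def lattice_path_def)
  ultimately show ?thesis by blast
qed

lemma finite_paths_to: "finite (paths_to m (int x, y))"
proof (induction x arbitrary: y)
  case 0
  then show ?case by (simp add: paths_to_outside table_def)
next
  case (Suc x)
  consider "(int (Suc x), y) \<notin> table m" | "(int (Suc x), y) \<in> table m" "x = 0"
    | "(int (Suc x), y) \<in> table m" "x \<noteq> 0" by blast
  then show ?case
  proof cases
    case 1
    then show ?thesis by (simp only: paths_to_outside[OF 1] finite.emptyI)
  next
    case 2
    then show ?thesis by (simp add: paths_to_first_column)
  next
    case 3
    then show ?thesis
      using Suc paths_to_step[OF 3(1)] by simp
  qed
qed

lemma path_count_outside: "y = 0 \<or> m < y \<Longrightarrow> path_count m x y = 0"
  by (auto simp: path_count_eq_card paths_to_outside table_def)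

lemma path_count_first_column:
  assumes "1 \<le> y" "y \<le> m"
  shows "path_count m 1 y = 1"
proof -
  have "(1, int y) \<in> table m" using assms by (simp add: table_def)
  then show ?thesis
    using paths_to_first_column[of "int y" m] by (simp add: path_count_eq_card)
qed

text \<open>The recursion starts at column \<open>1\<close> and is indexed so that no natural subtraction occurs.\<close>

lemma path_count_step:
  assumes "Suc y \<le> m"
  shows "path_count m (Suc (Suc x)) (Suc y) =
    path_count m (Suc x) y + path_count m (Suc x) (Suc y) + path_count m (Suc x) (Suc (Suc y))"
proof -
  let ?P = "\<lambda>z. paths_to m (int (Suc x), int z)"
  have cell: "(int (Suc (Suc x)), int (Suc y)) \<in> table m" "int (Suc (Suc x)) \<noteq> 1"
    using assms by (auto simp: table_def)
  have "paths_to m (int (Suc (Suc x)), int (Suc y)) =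
      (\<lambda>p. p @ [(int (Suc (Suc x)), int (Suc y))]) ` (?P y \<union> ?P (Suc y) \<union> ?P (Suc (Suc y)))"
    using paths_to_step[OF cell] by (simp add: algebra_simps)
  then have "path_count m (Suc (Suc x)) (Suc y) = card (?P y \<union> ?P (Suc y) \<union> ?P (Suc (Suc y)))"
    by (simp only: path_count_eq_card) (rule card_image, simp add: inj_on_def)
  moreover have "?P u \<inter> ?P v = {}" if "u \<noteq> v" for u v
    using that by (auto simp: paths_to_def)
  ultimately show ?thesis
    unfolding path_count_eq_card
    by (simp add: card_Un_disjoint finite_paths_to Int_Un_distrib2 del: of_nat_Suc)
qed

lemma path_count_reflect:
  "y + z = Suc m \<Longrightarrow> path_count m (Suc x) y = path_count m (Suc x) z"
proof (induction x arbitrary: y z)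
  case 0
  then show ?case
    using path_count_first_column[of y m] path_count_first_column[of z m]
      path_count_outside[of y m] path_count_outside[of z m]
    by (cases "1 \<le> y \<and> y \<le> m") auto
next
  case (Suc x)
  show ?case
  proof (cases "1 \<le> y \<and> y \<le> m")
    case False
    then show ?thesis
      using Suc.prems path_count_outside[of y m] path_count_outside[of z m] by auto
  next
    case True
    then obtain u v where uv: "y = Suc u" "z = Suc v"
      using Suc.prems by (cases y; cases z) auto
    then have "path_count m (Suc x) u = path_count m (Suc x) (Suc (Suc v))"
      "path_count m (Suc x) (Suc u) = path_count m (Suc x) (Suc v)"
      "path_count m (Suc x) (Suc (Suc u)) = path_count m (Suc x) v"
      using Suc.prems by (intro Suc.IH; simp)+
    then show ?thesis
      using uv Suc.prems by (simp add: path_count_step)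
  qed
qed

section \<open>Rows and column sums as multiples of the first row\<close>

text \<open>The \<open>y\<close>-th row as a sequence; index \<open>n\<close> stands for column \<open>n + 1\<close>.\<close>

definition row :: "nat \<Rightarrow> nat \<Rightarrow> nat \<Rightarrow> real" where
  "row m y n = real (path_count m (Suc n) y)"

lemma fwd_diff_row:
  assumes "Suc y \<le> m"
  shows "fwd_diff (row m (Suc y)) n = row m y n + row m (Suc (Suc y)) n"
  using path_count_step[OF assms, of n] by (simp add: fwd_diff_def row_def)

lemma act_multiplier_row_one:
  "j < m \<Longrightarrow> act (multiplier' j) (row m 1) = row m (Suc j)"
proof (induction j rule: multiplier'.induct)
  case 2
  then show ?case
    by (simp add: fun_eq_iff act_pCons fwd_diff_row row_def[of m 0] path_count_outside)
next
  case (3 j)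
  have "act (multiplier' (Suc (Suc j))) (row m 1) n =
      fwd_diff (row m (Suc (Suc j))) n - row m (Suc j) n" for n
    using 3 by (simp only: multiplier'.simps act_diff act_Delta_mult)
  then show ?case
    using 3 by (simp add: fun_eq_iff fwd_diff_row)
qed simp

lemma sum_reflection_symmetric:
  fixes f :: "nat \<Rightarrow> 'a::comm_monoid_add"
  assumes "k \<le> m" and "\<And>j. j < m \<Longrightarrow> f (m - Suc j) = f j"
  shows "sum f {..<m} = sum f {..<k} + sum f {..<m - k}"
proof -
  have "sum f {..<m} = sum f {..<k} + sum f {k..<m}"
    using assms(1) by (metis atLeast0LessThan sum.atLeastLessThan_concat zero_le)
  also have "sum f {k..<m} = sum f {..<m - k}"
    by (rule sum.reindex_bij_witness[where i = "\<lambda>j. m - Suc j" and j = "\<lambda>j. m - Suc j"])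
      (use assms in auto)
  finally show ?thesis .
qed

lemma column_sum_eq_act:
  assumes "m \<ge> 1" and "k = nat \<lceil>real m / 2\<rceil>"
  shows "(\<lambda>n. real (column_sum m (Suc n))) = act (total_multiplier m k) (row m 1)"
proof
  fix n
  have "m \<le> 2 * k" "2 * k < m + 2"
    using assms(2) by linarith+
  then have k: "k = (m + 1) div 2" by simp
  then have "k \<ge> 1" "k \<le> m" using assms(1) by auto
  let ?f = "\<lambda>j. row m (Suc j) n"
  have "real (column_sum m (Suc n)) = sum ?f {..<m}"
    by (simp add: column_sum_def row_def sum.atLeast1_atMost_eq)
  also have "\<dots> = sum ?f {..<k} + sum ?f {..<m - k}"
    using \<open>k \<le> m\<close>
    by (intro sum_reflection_symmetric) (auto simp: row_def intro!: path_count_reflect)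
  also have "sum ?f {..<k} = ?f (k - 1) + sum ?f {..<k - 1}"
    using \<open>k \<ge> 1\<close> by (cases k) auto
  \<comment> \<open>The factor \<open>2 / \<M>\<^sub>m(0) - 1\<close> is \<open>0\<close> for odd \<open>m\<close>, where row \<open>k\<close> is its own mirror image, and
    \<open>1\<close> for even \<open>m\<close>.\<close>
  also have "sum ?f {..<m - k} = (2 / multiplier_zero m - 1) * ?f (k - 1) + sum ?f {..<k - 1}"
  proof (cases "odd m")
    case True
    then have "m - k = k - 1" using k by (auto elim!: oddE)
    with True show ?thesis by (simp add: multiplier_zero_def)
  next
    case False
    then have "m - k = Suc (k - 1)" using k \<open>k \<ge> 1\<close> by (auto elim!: evenE)
    with False show ?thesis by (simp add: multiplier_zero_def)
  qed
  also have "?f (k - 1) + sum ?f {..<k - 1} +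
      ((2 / multiplier_zero m - 1) * ?f (k - 1) + sum ?f {..<k - 1}) =
      2 * (1 / multiplier_zero m * ?f (k - 1) + sum ?f {..<k - 1})"
    by (simp add: algebra_simps)
  also have "\<dots> = act (total_multiplier m k) (row m 1) n"
    using \<open>k \<ge> 1\<close> \<open>k \<le> m\<close> act_multiplier_row_one
    by (simp add: total_multiplier_def act_smult act_add act_sum del: One_nat_def)
  finally show "real (column_sum m (Suc n)) = act (total_multiplier m k) (row m 1) n" .
qed

theorem corollary2p5:
  fixes m k :: nat
  assumes "m \<ge> 1" and "k = nat \<lceil>real m / 2\<rceil>"
  shows "(\<forall>a\<in>{1..k}. \<forall>n\<ge>1.
            act (multiplier' (a - 1)) (\<lambda>n. real (column_sum m n)) n =
            act (total_multiplier m k) (\<lambda>n. real (path_count m n a)) n) \<and>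
         (\<forall>n\<ge>1. real (column_sum m n) =
            act (total_multiplier m k) (\<lambda>n. real (path_count m n 1)) n)"
proof -
  have row: "act p (\<lambda>n. real (path_count m n y)) (Suc n) = act p (row m y) n" for p y n
    by (simp add: act_shift row_def[abs_def])
  have "act (multiplier' (a - 1)) (\<lambda>n. real (column_sum m n)) (Suc n) =
      act (total_multiplier m k) (\<lambda>n. real (path_count m n a)) (Suc n)" if "a \<in> {1..k}" for a n
  proof -
    have "k \<le> m" using assms by linarith
    then have "row m a = act (multiplier' (a - 1)) (row m 1)"
      using that by (subst act_multiplier_row_one) auto
    then show ?thesis
      by (simp only: row act_shift[of _ "\<lambda>n. real (column_sum m n)"]
          column_sum_eq_act[OF assms] act_commute)
  qed
  moreover have "real (column_sum m (Suc n)) =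
      act (total_multiplier m k) (\<lambda>n. real (path_count m n 1)) (Suc n)" for n
    using fun_cong[OF column_sum_eq_act[OF assms], of n] by (simp only: row)
  ultimately show ?thesis
    by (metis One_nat_def Suc_le_D)
qed

end
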